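(* Let $T,L,c\in[0,\infty)$, $\varepsilon\in(0,\infty)$, $\gamma\in(0,1]$, let $\mu\colon[0,\infty)\to\mathbb{R}$ be Borel measurable, let $n\in\mathbb{N}_0$, $\theta=(t_0,\dots,t_n)\in[0,T]^{n+1}$ satisfy $0=t_0<t_1<\dots<t_n=T$, $L|\theta|<1$, and assume $$(x-y)(\mu(x)-\mu(y))\le L(x-y)^2,\qquad|\mu(x)-\mu(y)|\le c\,|x-y|\Big(\frac1x+\frac1y+\frac1{xy}+x^c+y^c\Big)$$ for all $x,y\in(0,\infty)$. Let $(\Omega,\mathcal{F},\mathbb{P},(\mathcal{F}_t)_{t\in[0,T]})$ be a stochastic basis, let $W\colon[0,T]\times\Omega\to\mathbb{R}$ be a standard $(\mathcal{F}_t)_{t\in[0,T]}$-Brownian motion, let $X\colon[0,T]\times\Omega\to[0,\infty)$ be an adapted stochastic process with continuous sample paths satisfying $\int_0^T|\mu(X_s)|\,ds<\infty$ $\mathbb{P}$-a.s., $\sup_{s\in[0,T]}\mathbb{P}[X_s=0]=0$ and $$X_t=X_0+\int_0^t\mu(X_s)\,ds+W_t$$ $\mathbb{P}$-a.s. for all $t\in[0,T]$, and let $Y\colon\{t_0,t_1,\dots,t_n\}\times\Omega\to[0,\infty)$ be a measurable mapping satisfying $Y_0=X_0$ and $$Y_{t_{k+1}}=Y_{t_k}+\mu(Y_{t_{k+1}})(t_{k+1}-t_k)+W_{t_{k+1}}-W_{t_k}$$ $\mathbb{P}$-a.s. for all $k\in\{0,\dots,n-1\}$. Then $$\begin{aligned}&\left\|\sup_{k\in\{0,1,\dots,n\}}|X_{t_k}-Y_{t_k}|\right\|_{L^1(\Omega;\mathbb{R})}\le2Tc\left(\tfrac{1}{1-|\theta|L}\right)^n\Big\|\sup_{u\in[0,T]}\big|X_u-X_{\lceil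 u\rceil_\theta}\big|\Big\|^\gamma_{L^{\gamma(1+1/\varepsilon)}(\Omega;\mathbb{R})}\\&\quad\cdot\sup_{u\in[0,T]}\left[\big\|\tfrac{2}{(X_u)^{1+\gamma}}\big\|_{L^{1+\varepsilon}(\Omega;\mathbb{R})}+\tfrac{\gamma}{1+\gamma}\big\|(X_u)^{\frac1\gamma-\gamma}\big\|_{L^{1+\varepsilon}(\Omega;\mathbb{R})}+2\big\|(X_u)^{c+1-\gamma}\big\|_{L^{1+\varepsilon}(\Omega;\mathbb{R})}+\tfrac1{1+\gamma}\right].\end{aligned}$$
   Context: A stochastic basis is a probability space with a normal filtration (right-continuous, $\mathcal{F}_0$ contains all $\mathbb{P}$-null sets). $|\theta|:=\max_{k\in\{1,\dots,n\}}|t_k-t_{k-1}|$ and $\lceil s\rceil_\theta:=\inf(\{t_0,\dots,t_n\}\cap[s,T])$ for $s\in[0,T]$. For $p\in(0,\infty)$, $\|V\|_{L^p(\Omega;\mathbb{R})}=(\mathbb{E}[|V|^p])^{1/p}\in[0,\infty]$. Expressions are computed in $[-\infty,\infty]$ with the conventions $0\cdot\infty=0$, $0^0=1$, $\frac a0=\infty$ for $a>0$. *)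

theory Defs
  imports "HOL-Probability.Probability"
begin

text \<open>
  Powers in \<open>[0, \<infinity>]\<close> with the conventions \<open>x\<^sup>0 = 1\<close> (also for \<open>x = 0\<close>, unlike \<open>powr\<close> on the reals)
  and \<open>0\<^sup>a = \<infinity>\<close>, \<open>\<infinity>\<^sup>a = 0\<close> for \<open>a < 0\<close>. The remaining conventions \<open>0 \<cdot> \<infinity> = 0\<close> and
  \<open>a / 0 = \<infinity>\<close> for \<open>a > 0\<close> are those of the type \<open>ennreal\<close>.
\<close>

definition ennpowr :: "ennreal \<Rightarrow> real \<Rightarrow> ennreal" where
  "ennpowr x a =
     (if a = 0 then 1
      else if x = 0 then (if a < 0 then \<infinity> else 0)
      else if x = \<infinity> then (if a < 0 then 0 else \<infinity>)
      else ennreal (enn2real x powr a))"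

lemma ennpowr_ennreal_pos: "0 < x \<Longrightarrow> ennpowr (ennreal x) a = ennreal (x powr a)"
  by (auto simp: ennpowr_def)

text \<open>
  The argument stands for \<open>|V|\<close>, since the random variables to which the norm is applied may take
  the value \<open>\<infinity>\<close> (such as \<open>2 / 0\<close>).
\<close>

definition Lp_norm :: "'a measure \<Rightarrow> real \<Rightarrow> ('a \<Rightarrow> ennreal) \<Rightarrow> ennreal" where
  "Lp_norm M p V = ennpowr (\<integral>\<^sup>+ \<omega>. ennpowr (V \<omega>) p \<partial>M) (1 / p)"

text \<open>
  A partition \<open>(t\<^sub>0, \<dots>, t\<^sub>n)\<close> is given by \<open>n\<close> and a function \<open>\<theta>\<close> of which only the values at
  \<open>0, \<dots>, n\<close> matter. For \<open>n = 0\<close> (which forces \<open>T = 0\<close>) the maximum over the empty set is read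
  as \<open>0\<close>; for \<open>n \<ge> 1\<close> inserting \<open>0\<close> does not change the maximum.
\<close>

definition time_partition :: "real \<Rightarrow> nat \<Rightarrow> (nat \<Rightarrow> real) \<Rightarrow> bool" where
  "time_partition T n \<theta> \<longleftrightarrow>
     (\<forall>k\<le>n. \<theta> k \<in> {0..T}) \<and> \<theta> 0 = 0 \<and> (\<forall>k<n. \<theta> k < \<theta> (Suc k)) \<and> \<theta> n = T"

definition mesh :: "nat \<Rightarrow> (nat \<Rightarrow> real) \<Rightarrow> real" where
  "mesh n \<theta> = Max (insert 0 ((\<lambda>k. \<bar>\<theta> k - \<theta> (k - 1)\<bar>) ` {1..n}))"

definition grid_ceil :: "real \<Rightarrow> nat \<Rightarrow> (nat \<Rightarrow> real) \<Rightarrow> real \<Rightarrow> real" where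
  "grid_ceil T n \<theta> s = Inf (\<theta> ` {0..n} \<inter> {s..T})"

text \<open>
  Filtrations and processes are indexed by \<open>[0, T]\<close>; their values at other times are irrelevant.
  In particular, right-continuity at time \<open>T\<close> is void.
\<close>

locale stochastic_basis = prob_space M
  for M :: "'a measure" and T :: real and F :: "real \<Rightarrow> 'a measure" +
  assumes subalgebra_F: "t \<in> {0..T} \<Longrightarrow> subalgebra M (F t)"
    and F_mono: "s \<in> {0..T} \<Longrightarrow> t \<in> {0..T} \<Longrightarrow> s \<le> t \<Longrightarrow> sets (F s) \<subseteq> sets (F t)"
    and F_right_continuous: "t \<in> {0..<T} \<Longrightarrow> sets (F t) = (\<Inter>s\<in>{t<..T}. sets (F s))"
    and F_null_sets: "null_sets M \<subseteq> sets (F 0)"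

definition adapted_process ::
    "real \<Rightarrow> (real \<Rightarrow> 'a measure) \<Rightarrow> (real \<Rightarrow> 'a \<Rightarrow> real) \<Rightarrow> bool" where
  "adapted_process T F X \<longleftrightarrow> (\<forall>t\<in>{0..T}. X t \<in> borel_measurable (F t))"

text \<open>
  The \<open>\<sigma>\<close>-algebra generated by an increment is written as a \<open>vimage_algebra\<close>; the increment is
  required to be independent of the \<open>\<sigma>\<close>-algebra at the earlier time. \<open>normal_density\<close> takes the
  standard deviation as its second argument.
\<close>

locale standard_brownian_motion = stochastic_basis M T F
  for M :: "'a measure" and T :: real and F :: "real \<Rightarrow> 'a measure" +
  fixes W :: "real \<Rightarrow> 'a \<Rightarrow> real"
  assumes adapted: "adapted_process T F W"
    and start_zero: "AE \<omega> in M. W 0 \<omega> = 0"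
    and continuous_paths: "AE \<omega> in M. continuous_on {0..T} (\<lambda>t. W t \<omega>)"
    and increment_indep: "0 \<le> s \<Longrightarrow> s < t \<Longrightarrow> t \<le> T \<Longrightarrow>
      indep_set (sets (F s)) (sets (vimage_algebra (space M) (\<lambda>\<omega>. W t \<omega> - W s \<omega>) borel))"
    and increment_normal: "0 \<le> s \<Longrightarrow> s < t \<Longrightarrow> t \<le> T \<Longrightarrow>
      distributed M lborel (\<lambda>\<omega>. W t \<omega> - W s \<omega>) (normal_density 0 (sqrt (t - s)))"

end

theory Submission
  imports Defs
begin

text \<open>
  Write \<open>X\<^sub>k\<close>, \<open>Y\<^sub>k\<close> for the values at the \<open>k\<close>-th grid point and \<open>h\<close> for the step size. The error
  \<open>e\<^sub>k = X\<^sub>k - Y\<^sub>k\<close> satisfies \<open>e\<^bsub>k+1\<^esub> = e\<^sub>k + R\<^sub>k + h (\<mu> X\<^bsub>k+1\<^esub> - \<mu> Y\<^bsub>k+1\<^esub>)\<close>, where \<open>R\<^sub>k\<close> integrates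
  \<open>\<mu> X\<^sub>s - \<mu> X\<^bsub>k+1\<^esub>\<close> over the step. Multiplying by \<open>e\<^bsub>k+1\<^esub>\<close>, the one-sided Lipschitz condition gives
  \<open>(1 - h L) \<bar>e\<^bsub>k+1\<^esub>\<bar> \<le> \<bar>e\<^sub>k\<bar> + \<bar>R\<^sub>k\<bar>\<close>, so the supremum of the errors is controlled by the sum of the
  \<open>\<bar>R\<^sub>k\<bar>\<close>. Their expectations are estimated by Tonelli's theorem, the growth condition (splitting
  \<open>\<bar>x - y\<bar>\<close> into the powers with exponents \<open>\<gamma>\<close> and \<open>1 - \<gamma>\<close> and using Young's inequality) and
  Hoelder's inequality.

  The conditions on \<open>\<mu>\<close> only concern positive arguments. That \<open>Y\<close> is almost surely positive holds
  because \<open>Y\<^bsub>k+1\<^esub> = 0\<close> would force \<open>Y\<^sub>k\<close> plus an independent Gaussian increment to hit a fixed value;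
  the independence needs \<open>Y\<close> to be adapted, which follows from the strict monotonicity of
  \<open>y - h \<mu> y\<close>.
\<close>

section \<open>Powers and Lp norms with values in [0, \<infinity>], and Hoelder's inequality\<close>

lemma ennpowr_one [simp]: "ennpowr x 1 = x"
  by (auto simp: ennpowr_def less_top)

lemma ennpowr_ennreal: "0 < a \<Longrightarrow> 0 \<le> r \<Longrightarrow> ennpowr (ennreal r) a = ennreal (r powr a)"
  by (auto simp: ennpowr_def)

lemma ennpowr_top: "0 < a \<Longrightarrow> ennpowr \<infinity> a = \<infinity>"
  by (auto simp: ennpowr_def)

lemma ennpowr_zero: "0 < a \<Longrightarrow> ennpowr 0 a = 0"
  by (auto simp: ennpowr_def)

lemma ennpowr_eq_0_iff: "0 < a \<Longrightarrow> ennpowr x a = 0 \<longleftrightarrow> x = 0"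
  by (cases x) (auto simp: ennpowr_ennreal ennpowr_top[unfolded infinity_ennreal_def])

lemma ennpowr_mono: "0 < a \<Longrightarrow> x \<le> y \<Longrightarrow> ennpowr x a \<le> ennpowr y a"
  by (cases x; cases y)
     (auto simp: ennpowr_ennreal ennpowr_top[unfolded infinity_ennreal_def] powr_mono2 top_unique)

lemma ennpowr_ennpowr: "0 < a \<Longrightarrow> 0 < b \<Longrightarrow> ennpowr (ennpowr x a) b = ennpowr x (a * b)"
  by (cases x) (auto simp: ennpowr_ennreal ennpowr_top[unfolded infinity_ennreal_def] powr_powr)

lemma measurable_ennpowr [measurable]:
  assumes "f \<in> borel_measurable M"
  shows "(\<lambda>x. ennpowr (f x) a) \<in> borel_measurable M"
  using assms unfolding ennpowr_def by measurable

lemma Lp_norm_mono: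
  assumes "0 < p" "\<And>\<omega>. \<omega> \<in> space M \<Longrightarrow> U \<omega> \<le> V \<omega>"
  shows "Lp_norm M p U \<le> Lp_norm M p V"
  unfolding Lp_norm_def using assms by (intro ennpowr_mono nn_integral_mono) auto

text \<open>This is Young's inequality for \<open>x / a\<close> and \<open>y / b\<close>, multiplied
  by \<open>a * b\<close>. The scaling serves Hoelder's inequality, where \<open>a\<close> and
  \<open>b\<close> are the norms of the two factors. If a factor is 0, the left side vanishes by
  \<open>0 * \<infinity> = 0\<close>; if a factor is infinite, so is the right side.\<close>

lemma ennreal_Young:
  fixes x y :: ennreal and a b p q :: real
  assumes "0 < a" "0 < b" "1 < p" "1 < q" "1 / p + 1 / q = 1"
  shows "x * y \<le> ennreal (a * b) *
           (ennreal (1 / (p * a powr p)) * ennpowr x p + ennreal (1 / (q * b powr q)) * ennpowr y q)"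
proof (cases "x = 0 \<or> y = 0 \<or> x = top \<or> y = top")
  case True
  with assms show ?thesis
    by (auto simp: ennpowr_zero ennpowr_top[unfolded infinity_ennreal_def] ennreal_mult_top
      ennreal_top_mult ennreal_mult_eq_top_iff)
next
  case False
  then obtain r s where rs: "x = ennreal r" "y = ennreal s" "0 < r" "0 < s"
    by (cases x; cases y) (auto simp: less_le)
  have "(r / a) * (s / b) \<le> (r / a) powr p / p + (s / b) powr q / q"
    using assms rs by (intro Youngs_inequality) auto
  then have "(a * b) * ((r / a) * (s / b)) \<le> (a * b) * ((r / a) powr p / p + (s / b) powr q / q)"
    using assms by (intro mult_left_mono) auto
  also have "(a * b) * ((r / a) * (s / b)) = r * s"
    using assms by simp
  also have "(a * b) * ((r / a) powr p / p + (s / b) powr q / q) = (a * b) * (1 / (p * a powr p) * r powr p + 1 / (q * b powr q) * s powr q)"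
    using assms rs by (simp add: powr_divide mult.commute)
  finally show ?thesis
    using assms rs by (simp add: ennpowr_ennreal ennreal_leI flip: ennreal_mult ennreal_plus)
qed

lemma ennpowr_inverse_real:
  assumes "0 < p" "A \<noteq> 0" "A \<noteq> top"
  obtains a where "0 < a" "ennpowr A (1 / p) = ennreal a" "A = ennreal (a powr p)"
proof -
  obtain r where r: "A = ennreal r" "0 < r"
    using assms by (cases A) (auto simp: less_le)
  show ?thesis
    using assms r by (intro that[of "r powr (1 / p)"]) (auto simp: ennpowr_ennreal powr_powr)
qed

lemma nn_integral_Holder:
  assumes [measurable]: "f \<in> borel_measurable M" "g \<in> borel_measurable M"
    and pq: "1 < p" "1 < q" "1 / p + 1 / q = 1"
  shows "(\<integral>\<^sup>+ x. f x * g x \<partial>M) \<le> Lp_norm M p f * Lp_norm M q g"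
proof -
  define A B where "A = (\<integral>\<^sup>+ x. ennpowr (f x) p \<partial>M)" and "B = (\<integral>\<^sup>+ x. ennpowr (g x) q \<partial>M)"
  have norms: "Lp_norm M p f = ennpowr A (1 / p)" "Lp_norm M q g = ennpowr B (1 / q)"
    by (auto simp: Lp_norm_def A_def B_def)
  consider "A = 0 \<or> B = 0" | "A = top \<or> B = top" "A \<noteq> 0" "B \<noteq> 0"
    | "A \<noteq> 0" "B \<noteq> 0" "A \<noteq> top" "B \<noteq> top" by auto
  then show ?thesis
  proof cases
    \<comment> \<open>A factor with vanishing norm is 0 almost everywhere, and then so is the
      product, even where the other factor is infinite.\<close>
    case 1
    then have "(AE x in M. f x = 0) \<or> (AE x in M. g x = 0)"
      using pq by (auto simp: A_def B_def nn_integral_0_iff_AE ennpowr_eq_0_iff)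
    then have "AE x in M. f x * g x = 0"
      by auto
    then have "(\<integral>\<^sup>+ x. f x * g x \<partial>M) = 0"
      by (simp add: nn_integral_0_iff_AE)
    then show ?thesis by simp
  next
    case 2
    then have "Lp_norm M p f * Lp_norm M q g = top"
      using pq by (auto simp: norms ennreal_mult_eq_top_iff ennpowr_eq_0_iff
        ennpowr_top[unfolded infinity_ennreal_def])
    then show ?thesis by simp
  next
    case 3
    \<comment> \<open>\<open>a\<close> and \<open>b\<close> are the two norms. With this scaling the
      Young terms integrate to \<open>1 / p\<close> and \<open>1 / q\<close>, which leaves exactly
      \<open>a * b\<close>.\<close>
    obtain a where a: "0 < a" "ennpowr A (1 / p) = ennreal a" "A = ennreal (a powr p)"
      using ennpowr_inverse_real[of p A] pq 3 by auto
    obtain b where b: "0 < b" "ennpowr B (1 / q) = ennreal b" "B = ennreal (b powr q)"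
      using ennpowr_inverse_real[of q B] pq 3 by auto
    have "(\<integral>\<^sup>+ x. f x * g x \<partial>M) \<le> (\<integral>\<^sup>+ x. ennreal (a * b) *
        (ennreal (1 / (p * a powr p)) * ennpowr (f x) p +
         ennreal (1 / (q * b powr q)) * ennpowr (g x) q) \<partial>M)"
      using a b pq by (intro nn_integral_mono ennreal_Young)
    also have "\<dots> = ennreal (a * b) *
        (ennreal (1 / (p * a powr p)) * A + ennreal (1 / (q * b powr q)) * B)"
      unfolding A_def B_def by (simp add: nn_integral_cmult nn_integral_add)
    also have "\<dots> = ennreal (a * b * (1 / p + 1 / q))"
      using a(1) b(1) pq unfolding a(3) b(3) by (simp flip: ennreal_mult ennreal_plus)
    also have "\<dots> = ennreal a * ennreal b"
      using a(1) b(1) by (simp add: pq(3) ennreal_mult)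
    finally show ?thesis
      by (simp add: norms a(2) b(2))
  qed
qed

section \<open>From the growth condition to a bound on expected drift differences\<close>

text \<open>Since \<open>y - x \<le> y\<close>, the factor
  \<open>(y - x) powr (1 - \<gamma>)\<close> is at most \<open>y powr (1 - \<gamma>)\<close>. The
  latter is multiplied into the five summands, which are then estimated one by one.\<close>

lemma growth_weight_bound:
  fixes c \<gamma> x y :: real
  assumes c: "0 \<le> c" and g: "0 < \<gamma>" "\<gamma> \<le> 1" and xy: "0 < x" "x \<le> y"
  shows "(y - x) * (1 / x + 1 / y + 1 / (x * y) + x powr c + y powr c)
    \<le> (y - x) powr \<gamma> *
       (2 / x powr (1 + \<gamma>) + 2 / y powr (1 + \<gamma>)
        + \<gamma> / (1 + \<gamma>) * y powr (1 / \<gamma> - \<gamma>) + 2 * y powr (c + 1 - \<gamma>) + 1 / (1 + \<gamma>))"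
proof -
  have y: "0 < y" using xy by simp
  have split: "y - x = (y - x) powr \<gamma> * (y - x) powr (1 - \<gamma>)"
    using xy by (simp flip: powr_add)
  have le1: "(y - x) powr (1 - \<gamma>) \<le> y powr (1 - \<gamma>)"
    using xy g by (intro powr_mono2) auto
  \<comment> \<open>Young's inequality with the conjugate exponents
    \<open>(1 + \<gamma>) / \<gamma>\<close> and \<open>1 + \<gamma>\<close>. The exponent
    \<open>1 / \<gamma> - \<gamma>\<close> is
    \<open>(1 - \<gamma>) * (1 + \<gamma>) / \<gamma>\<close>.\<close>
  have a: "y powr (1 - \<gamma>) * (1 / x) \<le>
      \<gamma> / (1 + \<gamma>) * y powr (1 / \<gamma> - \<gamma>) + 1 / (1 + \<gamma>) * (1 / x powr (1 + \<gamma>))"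
  proof -
    have "y powr (1 - \<gamma>) * (1 / x) \<le>
      (y powr (1 - \<gamma>)) powr ((1 + \<gamma>) / \<gamma>) / ((1 + \<gamma>) / \<gamma>) + (1 / x) powr (1 + \<gamma>) / (1 + \<gamma>)"
      using g xy by (intro Youngs_inequality) (auto simp: field_simps)
    also have "(y powr (1 - \<gamma>)) powr ((1 + \<gamma>) / \<gamma>) = y powr (1 / \<gamma> - \<gamma>)"
      using g by (simp add: powr_powr field_simps)
    finally show ?thesis using g xy by (simp add: powr_divide field_simps)
  qed
  \<comment> \<open>The same exponents, now for the product of \<open>y powr (- \<gamma>)\<close>
    and 1; the second factor yields the constant \<open>1 / (1 + \<gamma>)\<close>.\<close>
  have b: "y powr (1 - \<gamma>) * (1 / y) \<le> \<gamma> / (1 + \<gamma>) * (1 / y powr (1 + \<gamma>)) + 1 / (1 + \<gamma>)"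
  proof -
    have "y powr (1 - \<gamma>) * (1 / y) = y powr (- \<gamma>) * 1"
      using y by (simp add: powr_diff powr_minus field_simps)
    also have "\<dots> \<le> (y powr (- \<gamma>)) powr ((1 + \<gamma>) / \<gamma>) / ((1 + \<gamma>) / \<gamma>) + 1 powr (1 + \<gamma>) / (1 + \<gamma>)"
      using g xy by (intro Youngs_inequality) (auto simp: field_simps)
    also have "(y powr (- \<gamma>)) powr ((1 + \<gamma>) / \<gamma>) = 1 / y powr (1 + \<gamma>)"
    proof -
      have "- \<gamma> * ((1 + \<gamma>) / \<gamma>) = - (1 + \<gamma>)" using g by (simp add: field_simps)
      then show ?thesis unfolding powr_powr by (simp only: powr_minus_divide)
    qed
    finally show ?thesis using g y by (simp add: field_simps)
  qed
  have d: "y powr (1 - \<gamma>) * (1 / (x * y)) \<le> 1 / x powr (1 + \<gamma>)"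
  proof -
    have "y powr (1 - \<gamma>) * (1 / (x * y)) = y powr (- \<gamma>) / x"
      using xy y by (simp add: powr_diff powr_minus field_simps)
    also have "\<dots> \<le> x powr (- \<gamma>) / x"
      using xy g by (intro divide_right_mono powr_mono2') auto
    also have "\<dots> = 1 / x powr (1 + \<gamma>)"
      using xy by (simp add: powr_add powr_minus field_simps)
    finally show ?thesis .
  qed
  have e: "y powr (1 - \<gamma>) * (x powr c + y powr c) \<le> 2 * y powr (c + 1 - \<gamma>)"
  proof -
    have "y powr (1 - \<gamma>) * (x powr c + y powr c) \<le> y powr (1 - \<gamma>) * (y powr c + y powr c)"
      using xy c by (intro mult_left_mono add_mono powr_mono2) auto
    also have "\<dots> = 2 * y powr (c + 1 - \<gamma>)"
      using y by (simp add: powr_add powr_diff)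
    finally show ?thesis .
  qed
  \<comment> \<open>The coefficient 2 of \<open>1 / x powr (1 + \<gamma>)\<close> collects at most 1
    from \<open>a\<close> and 1 from \<open>d\<close>; the one at \<open>y\<close> only has to
    absorb the term from \<open>b\<close>.\<close>
  have f: "1 / (1 + \<gamma>) * (1 / x powr (1 + \<gamma>)) \<le> 1 / x powr (1 + \<gamma>)"
    "\<gamma> / (1 + \<gamma>) * (1 / y powr (1 + \<gamma>)) \<le> 2 / y powr (1 + \<gamma>)"
  proof -
    show "1 / (1 + \<gamma>) * (1 / x powr (1 + \<gamma>)) \<le> 1 / x powr (1 + \<gamma>)"
      using g by (intro mult_left_le_one_le) auto
    have "\<gamma> / (1 + \<gamma>) * (1 / y powr (1 + \<gamma>)) \<le> 2 * (1 / y powr (1 + \<gamma>))"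
      using g by (intro mult_right_mono) (auto simp: field_simps)
    then show "\<gamma> / (1 + \<gamma>) * (1 / y powr (1 + \<gamma>)) \<le> 2 / y powr (1 + \<gamma>)" by simp
  qed
  have "(y - x) * (1 / x + 1 / y + 1 / (x * y) + x powr c + y powr c) =
      (y - x) powr \<gamma> * ((y - x) powr (1 - \<gamma>) * (1 / x + 1 / y + 1 / (x * y) + x powr c + y powr c))"
    by (subst split) simp
  also have "\<dots> \<le> (y - x) powr \<gamma> *
      (y powr (1 - \<gamma>) * (1 / x + 1 / y + 1 / (x * y) + x powr c + y powr c))"
    using xy y by (intro mult_left_mono mult_right_mono le1) (auto intro!: add_nonneg_nonneg)
  also have "\<dots> \<le> (y - x) powr \<gamma> *
       (2 / x powr (1 + \<gamma>) + 2 / y powr (1 + \<gamma>)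
        + \<gamma> / (1 + \<gamma>) * y powr (1 / \<gamma> - \<gamma>) + 2 * y powr (c + 1 - \<gamma>) + 1 / (1 + \<gamma>))"
    using a b d e f by (intro mult_left_mono) (auto simp: distrib_left)
  finally show ?thesis .
qed

text \<open>This is the bracket of the claimed bound before norms are taken. Values in
  [0, \<infinity>] allow \<open>x = 0\<close>, where the first summand is infinite.\<close>

definition weight :: "real \<Rightarrow> real \<Rightarrow> real \<Rightarrow> ennreal" where
  "weight c \<gamma> x =
     2 / ennpowr (ennreal x) (1 + \<gamma>) + ennreal (\<gamma> / (1 + \<gamma>)) * ennpowr (ennreal x) (1 / \<gamma> - \<gamma>)
     + 2 * ennpowr (ennreal x) (c + 1 - \<gamma>) + ennreal (1 / (1 + \<gamma>))"

text \<open>The bracket inside the supremum of the theorem. Norms are taken summand by summand with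
  the constants outside, so Hoelder's inequality can be applied to each summand on its own.\<close>

definition weight_norm :: "'a measure \<Rightarrow> real \<Rightarrow> real \<Rightarrow> real \<Rightarrow> ('a \<Rightarrow> real) \<Rightarrow> ennreal" where
  "weight_norm M c \<gamma> \<epsilon> U =
     Lp_norm M (1 + \<epsilon>) (\<lambda>\<omega>. 2 / ennpowr (ennreal (U \<omega>)) (1 + \<gamma>))
     + ennreal (\<gamma> / (1 + \<gamma>)) * Lp_norm M (1 + \<epsilon>) (\<lambda>\<omega>. ennpowr (ennreal (U \<omega>)) (1 / \<gamma> - \<gamma>))
     + 2 * Lp_norm M (1 + \<epsilon>) (\<lambda>\<omega>. ennpowr (ennreal (U \<omega>)) (c + 1 - \<gamma>))
     + ennreal (1 / (1 + \<gamma>))"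

lemma weight_pos:
  assumes "0 < x" "0 < \<gamma>"
  shows "weight c \<gamma> x = ennreal (2 / x powr (1 + \<gamma>) + \<gamma> / (1 + \<gamma>) * x powr (1 / \<gamma> - \<gamma>)
    + 2 * x powr (c + 1 - \<gamma>) + 1 / (1 + \<gamma>))"
proof -
  have two: "(2::ennreal) = ennreal 2" by simp
  show ?thesis
    unfolding weight_def two using assms
    by (simp add: ennpowr_ennreal_pos divide_ennreal del: ennreal_numeral flip: ennreal_mult ennreal_plus)
qed

text \<open>The preceding bound treats the smaller and the larger argument differently. Adding the
  nonnegative summands that are missing for the smaller one makes the right side symmetric, so that
  both orderings of \<open>x\<close> and \<open>y\<close> are covered.\<close>

lemma drift_difference_le_weight:
  fixes \<mu> :: "real \<Rightarrow> real"
  assumes c: "0 \<le> c" and g: "0 < \<gamma>" "\<gamma> \<le> 1" and xy: "0 < x" "0 < y"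
    and growth: "\<bar>\<mu> x - \<mu> y\<bar> \<le> c * \<bar>x - y\<bar> * (1 / x + 1 / y + 1 / (x * y) + x powr c + y powr c)"
  shows "ennreal \<bar>\<mu> x - \<mu> y\<bar>
    \<le> ennreal c * (ennpowr (ennreal \<bar>x - y\<bar>) \<gamma> * (weight c \<gamma> x + weight c \<gamma> y))"
proof -
  define w where "w z = 2 / z powr (1 + \<gamma>) + \<gamma> / (1 + \<gamma>) * z powr (1 / \<gamma> - \<gamma>)
    + 2 * z powr (c + 1 - \<gamma>) + 1 / (1 + \<gamma>)" for z
  have w_nonneg: "0 \<le> w z" for z
    using g by (simp add: w_def)
  have *: "(v - u) * (1 / u + 1 / v + 1 / (u * v) + u powr c + v powr c)
      \<le> (v - u) powr \<gamma> * (w u + w v)" if "0 < u" "u \<le> v" for u v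
  proof (rule order_trans[OF growth_weight_bound[OF c g that]])
    have "0 \<le> \<gamma> / (1 + \<gamma>) * u powr (1 / \<gamma> - \<gamma>)" "0 \<le> 2 * u powr (c + 1 - \<gamma>)" "0 \<le> 1 / (1 + \<gamma>)"
      using g by auto
    then show "(v - u) powr \<gamma> *
       (2 / u powr (1 + \<gamma>) + 2 / v powr (1 + \<gamma>)
        + \<gamma> / (1 + \<gamma>) * v powr (1 / \<gamma> - \<gamma>) + 2 * v powr (c + 1 - \<gamma>) + 1 / (1 + \<gamma>))
       \<le> (v - u) powr \<gamma> * (w u + w v)"
      unfolding w_def by (intro mult_left_mono) (linarith, simp)
  qed
  have "\<bar>x - y\<bar> * (1 / x + 1 / y + 1 / (x * y) + x powr c + y powr c)
      \<le> \<bar>x - y\<bar> powr \<gamma> * (w x + w y)"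
  proof (cases "x \<le> y")
    case True
    then show ?thesis using *[OF xy(1) True] by (simp add: abs_minus_commute)
  next
    case False
    then show ?thesis using *[OF xy(2), of x] by (simp add: ac_simps)
  qed
  from mult_left_mono[OF this c] growth
  have "\<bar>\<mu> x - \<mu> y\<bar> \<le> c * (\<bar>x - y\<bar> powr \<gamma> * (w x + w y))"
    by (simp add: mult.assoc)
  moreover have "weight c \<gamma> x = ennreal (w x)" "weight c \<gamma> y = ennreal (w y)"
    using xy g by (simp_all add: weight_pos w_def)
  ultimately show ?thesis
    using c g xy w_nonneg[of x] w_nonneg[of y]
    by (simp add: ennpowr_ennreal ennreal_leI flip: ennreal_mult ennreal_plus)
qed

lemma measurable_weight [measurable]:
  assumes "U \<in> borel_measurable M"
  shows "(\<lambda>\<omega>. weight c \<gamma> (U \<omega>)) \<in> borel_measurable M"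
  using assms unfolding weight_def by measurable

lemma Lp_norm_ennpowr:
  assumes "0 < \<gamma>" "0 < p"
  shows "Lp_norm M p (\<lambda>\<omega>. ennpowr (d \<omega>) \<gamma>) = ennpowr (Lp_norm M (\<gamma> * p) d) \<gamma>"
  using assms by (simp add: Lp_norm_def ennpowr_ennpowr)

text \<open>Hoelder's inequality with the conjugate exponents \<open>1 + 1 / \<epsilon>\<close> and
  \<open>1 + \<epsilon>\<close>. The first one acts on a power \<gamma> of \<open>d\<close>, whence
  the norm of exponent \<open>\<gamma> * (1 + 1 / \<epsilon>)\<close> raised to the power
  \<gamma>.\<close>

lemma (in prob_space) nn_integral_weight_le:
  assumes [measurable]: "d \<in> borel_measurable M" "U \<in> borel_measurable M"
    and "0 < \<epsilon>" "0 < \<gamma>"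
  shows "(\<integral>\<^sup>+ \<omega>. ennpowr (d \<omega>) \<gamma> * weight c \<gamma> (U \<omega>) \<partial>M)
    \<le> ennpowr (Lp_norm M (\<gamma> * (1 + 1 / \<epsilon>)) d) \<gamma> * weight_norm M c \<gamma> \<epsilon> U"
proof -
  have exps: "1 < 1 + 1 / \<epsilon>" "1 < 1 + \<epsilon>" "1 / (1 + 1 / \<epsilon>) + 1 / (1 + \<epsilon>) = 1"
    using assms by (auto simp: field_simps)
  define N where "N = ennpowr (Lp_norm M (\<gamma> * (1 + 1 / \<epsilon>)) d) \<gamma>"
  have H: "(\<integral>\<^sup>+ \<omega>. ennpowr (d \<omega>) \<gamma> * g \<omega> \<partial>M) \<le> N * Lp_norm M (1 + \<epsilon>) g"
    if "g \<in> borel_measurable M" for g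
  proof -
    have "Lp_norm M (1 + 1 / \<epsilon>) (\<lambda>\<omega>. ennpowr (d \<omega>) \<gamma>) = N"
      unfolding N_def using assms by (intro Lp_norm_ennpowr) (auto intro: add_pos_pos)
    then show ?thesis
      using nn_integral_Holder[OF _ that exps, of "\<lambda>\<omega>. ennpowr (d \<omega>) \<gamma>"] by simp
  qed
  \<comment> \<open>For the constant summand of the weight the second factor is 1, whose norm is 1
    because the total mass is 1.\<close>
  have "Lp_norm M (1 + \<epsilon>) (\<lambda>_. 1) = 1"
    using assms by (simp add: Lp_norm_def ennpowr_def emeasure_space_1 flip: infinity_ennreal_def)
  then have H1: "(\<integral>\<^sup>+ \<omega>. ennpowr (d \<omega>) \<gamma> \<partial>M) \<le> N"
    using H[of "\<lambda>_. 1"] by simp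
  have "(\<integral>\<^sup>+ \<omega>. ennpowr (d \<omega>) \<gamma> * weight c \<gamma> (U \<omega>) \<partial>M) =
      (\<integral>\<^sup>+ \<omega>. ennpowr (d \<omega>) \<gamma> * (2 / ennpowr (ennreal (U \<omega>)) (1 + \<gamma>))
        + ennreal (\<gamma> / (1 + \<gamma>)) * (ennpowr (d \<omega>) \<gamma> * ennpowr (ennreal (U \<omega>)) (1 / \<gamma> - \<gamma>))
        + 2 * (ennpowr (d \<omega>) \<gamma> * ennpowr (ennreal (U \<omega>)) (c + 1 - \<gamma>))
        + ennreal (1 / (1 + \<gamma>)) * ennpowr (d \<omega>) \<gamma> \<partial>M)"
    by (intro nn_integral_cong) (simp add: weight_def distrib_left ac_simps)
  also have "\<dots> = (\<integral>\<^sup>+ \<omega>. ennpowr (d \<omega>) \<gamma> * (2 / ennpowr (ennreal (U \<omega>)) (1 + \<gamma>)) \<partial>M)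
        + ennreal (\<gamma> / (1 + \<gamma>)) * (\<integral>\<^sup>+ \<omega>. ennpowr (d \<omega>) \<gamma> * ennpowr (ennreal (U \<omega>)) (1 / \<gamma> - \<gamma>) \<partial>M)
        + 2 * (\<integral>\<^sup>+ \<omega>. ennpowr (d \<omega>) \<gamma> * ennpowr (ennreal (U \<omega>)) (c + 1 - \<gamma>) \<partial>M)
        + ennreal (1 / (1 + \<gamma>)) * (\<integral>\<^sup>+ \<omega>. ennpowr (d \<omega>) \<gamma> \<partial>M)"
    by (simp add: nn_integral_add nn_integral_cmult)
  also have "\<dots> \<le> N * Lp_norm M (1 + \<epsilon>) (\<lambda>\<omega>. 2 / ennpowr (ennreal (U \<omega>)) (1 + \<gamma>))
        + ennreal (\<gamma> / (1 + \<gamma>)) *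
          (N * Lp_norm M (1 + \<epsilon>) (\<lambda>\<omega>. ennpowr (ennreal (U \<omega>)) (1 / \<gamma> - \<gamma>)))
        + 2 * (N * Lp_norm M (1 + \<epsilon>) (\<lambda>\<omega>. ennpowr (ennreal (U \<omega>)) (c + 1 - \<gamma>)))
        + ennreal (1 / (1 + \<gamma>)) * N"
    by (intro add_mono mult_left_mono H H1) measurable
  also have "\<dots> = N * weight_norm M c \<gamma> \<epsilon> U"
    by (simp add: weight_norm_def distrib_left ac_simps)
  finally show ?thesis by (simp add: N_def)
qed

text \<open>The weights at \<open>U\<close> and at \<open>V\<close> each contribute at most
  \<open>K\<close>, which accounts for the factor 2 in \<open>2 * c\<close>.\<close>

lemma (in prob_space) nn_integral_drift_difference_le:
  fixes \<mu> :: "real \<Rightarrow> real" and D :: "'a \<Rightarrow> ennreal"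
  assumes [measurable]: "U \<in> borel_measurable M" "V \<in> borel_measurable M"
    and pos: "AE \<omega> in M. 0 < U \<omega>" "AE \<omega> in M. 0 < V \<omega>"
    and c: "0 \<le> c" and eps: "0 < \<epsilon>" and g: "0 < \<gamma>" "\<gamma> \<le> 1"
    and growth: "\<And>x y. 0 < x \<Longrightarrow> 0 < y \<Longrightarrow>
      \<bar>\<mu> x - \<mu> y\<bar> \<le> c * \<bar>x - y\<bar> * (1 / x + 1 / y + 1 / (x * y) + x powr c + y powr c)"
    and D: "\<And>\<omega>. \<omega> \<in> space M \<Longrightarrow> ennreal \<bar>U \<omega> - V \<omega>\<bar> \<le> D \<omega>"
    and K: "weight_norm M c \<gamma> \<epsilon> U \<le> K" "weight_norm M c \<gamma> \<epsilon> V \<le> K"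
  shows "(\<integral>\<^sup>+ \<omega>. ennreal \<bar>\<mu> (U \<omega>) - \<mu> (V \<omega>)\<bar> \<partial>M)
    \<le> ennreal (2 * c) * ennpowr (Lp_norm M (\<gamma> * (1 + 1 / \<epsilon>)) D) \<gamma> * K"
proof -
  define d where "d \<omega> = ennreal \<bar>U \<omega> - V \<omega>\<bar>" for \<omega>
  define N where "N = ennpowr (Lp_norm M (\<gamma> * (1 + 1 / \<epsilon>)) d) \<gamma>"
  have [measurable]: "d \<in> borel_measurable M"
    unfolding d_def by measurable
  have "(\<integral>\<^sup>+ \<omega>. ennreal \<bar>\<mu> (U \<omega>) - \<mu> (V \<omega>)\<bar> \<partial>M)
      \<le> (\<integral>\<^sup>+ \<omega>. ennreal c * (ennpowr (d \<omega>) \<gamma> * weight c \<gamma> (U \<omega>) + ennpowr (d \<omega>) \<gamma> * weight c \<gamma> (V \<omega>)) \<partial>M)"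
  proof (rule nn_integral_mono_AE)
    show "AE \<omega> in M. ennreal \<bar>\<mu> (U \<omega>) - \<mu> (V \<omega>)\<bar>
      \<le> ennreal c * (ennpowr (d \<omega>) \<gamma> * weight c \<gamma> (U \<omega>) + ennpowr (d \<omega>) \<gamma> * weight c \<gamma> (V \<omega>))"
      using pos
    proof eventually_elim
      case (elim \<omega>)
      show ?case
        using drift_difference_le_weight[OF c g elim growth[OF elim]]
        by (simp add: d_def distrib_left)
    qed
  qed
  also have "\<dots> = ennreal c * ((\<integral>\<^sup>+ \<omega>. ennpowr (d \<omega>) \<gamma> * weight c \<gamma> (U \<omega>) \<partial>M)
      + (\<integral>\<^sup>+ \<omega>. ennpowr (d \<omega>) \<gamma> * weight c \<gamma> (V \<omega>) \<partial>M))"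
    by (simp add: nn_integral_cmult nn_integral_add)
  also have "\<dots> \<le> ennreal c * (N * weight_norm M c \<gamma> \<epsilon> U + N * weight_norm M c \<gamma> \<epsilon> V)"
    unfolding N_def using eps g by (intro mult_left_mono add_mono nn_integral_weight_le) auto
  also have "\<dots> \<le> ennreal c * (N * K + N * K)"
    by (intro mult_left_mono add_mono K) auto
  also have "\<dots> = ennreal (2 * c) * N * K"
    using c by (simp add: ennreal_mult mult_2[symmetric] ac_simps)
  \<comment> \<open>Hoelder's inequality was applied to the measurable distance \<open>d\<close>.
    The majorant \<open>D\<close>, later a supremum over uncountably many times, enters only through
    monotonicity of the norm.\<close>
  also have "\<dots> \<le> ennreal (2 * c) * ennpowr (Lp_norm M (\<gamma> * (1 + 1 / \<epsilon>)) D) \<gamma> * K"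
    unfolding N_def using g eps D
    by (intro mult_right_mono mult_left_mono ennpowr_mono Lp_norm_mono)
       (auto simp: d_def add_pos_pos)
  finally show ?thesis .
qed

section \<open>Absence of atoms, and measurability of implicit steps and of continuous
  processes\<close>

text \<open>By independence the joint law of \<open>U\<close> and \<open>V\<close> is a product. For
  each fixed \<open>u\<close> the section of the line \<open>u + v = a\<close> is the single point
  \<open>a - u\<close>, a null set for the law of \<open>V\<close>, which has a density.\<close>

lemma (in prob_space) indep_sum_no_atom:
  fixes U V :: "'a \<Rightarrow> real"
  assumes sub: "subalgebra M G" and U: "U \<in> borel_measurable G"
    and indep: "indep_set (sets G) (sets (vimage_algebra (space M) V borel))"
    and V: "distributed M lborel V f"
  shows "AE \<omega> in M. U \<omega> + V \<omega> \<noteq> a"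
proof -
  have UM [measurable]: "U \<in> borel_measurable M"
    using measurable_from_subalg[OF sub U] .
  have VM [measurable]: "V \<in> borel_measurable M"
    using V by (simp add: distributed_def)
  have "space M \<in> sets G"
    using sub sets.top[of G] by (simp add: subalgebra_def)
  then have "sigma_sets (space M) {U -` A \<inter> space M |A. A \<in> sets borel} \<subseteq> sets G"
    using sub U measurable_sets[OF U]
    by (intro sets.sigma_sets_subset') (auto simp: subalgebra_def)
  then have "indep_var borel U borel V"
    using indep unfolding indep_var_eq sets_vimage_algebra indep_sets2_eq by auto
  then have eq: "distr M borel U \<Otimes>\<^sub>M distr M borel V = distr M (borel \<Otimes>\<^sub>M borel) (\<lambda>x. (U x, V x))"
    by (simp add: indep_var_distribution_eq)
  interpret V: prob_space "distr M borel V" by (rule prob_space_distr) simp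
  have null: "emeasure (distr M borel V) {b} = 0" for b
  proof -
    have "distr M borel V = distr M lborel V"
      by (rule distr_cong) auto
    then have "distr M borel V = density lborel f"
      using V by (simp add: distributed_def)
    moreover have "emeasure (density lborel f) {b} = 0"
      using V AE_lborel_singleton[of b]
      by (subst emeasure_density) (auto simp: distributed_def nn_integral_0_iff_AE indicator_def elim!: eventually_mono)
    ultimately show ?thesis by simp
  qed
  define S where "S = {p \<in> space (borel \<Otimes>\<^sub>M borel). fst p + snd p = a}"
  have S [measurable]: "S \<in> sets (borel \<Otimes>\<^sub>M borel)"
    unfolding S_def by measurable
  have "emeasure M {\<omega> \<in> space M. U \<omega> + V \<omega> = a} = emeasure (distr M (borel \<Otimes>\<^sub>M borel) (\<lambda>x. (U x, V x))) S"
    by (subst emeasure_distr[OF _ S])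
       (measurable, auto simp: S_def space_pair_measure intro!: arg_cong[where f="emeasure M"])
  also have "\<dots> = (\<integral>\<^sup>+ u. emeasure (distr M borel V) (Pair u -` S) \<partial>distr M borel U)"
    unfolding eq[symmetric] by (rule V.emeasure_pair_measure_alt) (simp cong: sets_pair_measure_cong)
  also have "\<dots> = (\<integral>\<^sup>+ u. emeasure (distr M borel V) {a - u} \<partial>distr M borel U)"
    by (intro nn_integral_cong arg_cong[where f="emeasure _"]) (auto simp: S_def space_pair_measure)
  also have "\<dots> = 0"
    by (simp add: null)
  finally show ?thesis
    by (subst AE_iff_measurable[OF _ refl]) auto
qed

text \<open>\<open>A\<close> arises from \<open>B\<close> by removing \<open>B - A\<close> and
  adding \<open>A - B\<close>; both are null sets and hence belong to \<open>G\<close>.\<close>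

lemma sets_subalgebra_AE_eq:
  assumes sub: "subalgebra M G" and null: "null_sets M \<subseteq> sets G"
    and A: "A \<in> sets M" and B: "B \<in> sets G" and ae: "AE \<omega> in M. \<omega> \<in> A \<longleftrightarrow> \<omega> \<in> B"
  shows "A \<in> sets G"
proof -
  have BM: "B \<in> sets M" using B sub by (auto simp: subalgebra_def)
  have "A - B \<in> null_sets M" "B - A \<in> null_sets M"
    using ae A BM by (auto simp: AE_iff_null_sets elim!: eventually_mono)
  then have "(B - (B - A)) \<union> (A - B) \<in> sets G"
    using null B by auto
  also have "(B - (B - A)) \<union> (A - B) = A" by auto
  finally show ?thesis .
qed

text \<open>Because \<open>h * L < 1\<close>, the map \<open>y - h * \<mu> y\<close> is strictly
  increasing on the positive reals. So for \<open>a > 0\<close> the event \<open>V \<le> a\<close>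
  agrees almost surely with \<open>Z \<le> a - h * \<mu> a\<close>, and for \<open>a \<le> 0\<close>
  it is a null event. Null events are in \<open>G\<close>.\<close>

lemma implicit_step_measurable:
  fixes V Z :: "'a \<Rightarrow> real"
  assumes sub: "subalgebra M G" and null: "null_sets M \<subseteq> sets G"
    and V: "V \<in> borel_measurable M" and Z: "Z \<in> borel_measurable G"
    and pos: "AE \<omega> in M. 0 < V \<omega>"
    and step: "AE \<omega> in M. V \<omega> = Z \<omega> + \<mu> (V \<omega>) * h"
    and h: "0 \<le> h" "h * L < 1"
    and mu: "\<And>x y. 0 < x \<Longrightarrow> 0 < y \<Longrightarrow> (x - y) * (\<mu> x - \<mu> y) \<le> L * (x - y)\<^sup>2"
  shows "V \<in> borel_measurable G"
proof -
  have space: "space G = space M" using sub by (simp add: subalgebra_def)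
  have mono: "x - h * \<mu> x < y - h * \<mu> y" if "0 < x" "x < y" for x y
  proof -
    have "(y - x) * (\<mu> y - \<mu> x) \<le> (y - x) * (L * (y - x))"
      using mu[of y x] that by (simp add: power2_eq_square ac_simps)
    then have "\<mu> y - \<mu> x \<le> L * (y - x)"
      using that by simp
    then have "h * (\<mu> y - \<mu> x) \<le> h * (L * (y - x))"
      using h by (intro mult_left_mono) auto
    also have "\<dots> < 1 * (y - x)"
      unfolding mult.assoc[symmetric] using h that by (intro mult_strict_right_mono) auto
    finally show ?thesis by (simp add: algebra_simps)
  qed
  show ?thesis
    unfolding borel_measurable_iff_le
  proof
    fix a :: real
    have Ma: "{\<omega> \<in> space M. V \<omega> \<le> a} \<in> sets M"
      using V by measurable
    show "{\<omega> \<in> space G. V \<omega> \<le> a} \<in> sets G"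
    proof (cases "0 < a")
      case True
      have "AE \<omega> in M. V \<omega> \<le> a \<longleftrightarrow> Z \<omega> \<le> a - h * \<mu> a"
        using pos step
      proof eventually_elim
        case (elim \<omega>)
        then have Zeq: "Z \<omega> = V \<omega> - h * \<mu> (V \<omega>)" by (simp add: mult.commute)
        show ?case
          using mono[of a "V \<omega>"] mono[of "V \<omega>" a] True elim(1) unfolding Zeq
          by (cases "V \<omega>" a rule: linorder_cases) auto
      qed
      then have "AE \<omega> in M. \<omega> \<in> {\<omega> \<in> space M. V \<omega> \<le> a} \<longleftrightarrow> \<omega> \<in> {\<omega> \<in> space G. Z \<omega> \<le> a - h * \<mu> a}"
        by (auto simp: space)
      moreover have "{\<omega> \<in> space G. Z \<omega> \<le> a - h * \<mu> a} \<in> sets G"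
        using Z unfolding borel_measurable_iff_le by blast
      ultimately show ?thesis
        unfolding space by (intro sets_subalgebra_AE_eq[OF sub null Ma])
    next
      case False
      then have "AE \<omega> in M. \<omega> \<in> {\<omega> \<in> space M. V \<omega> \<le> a} \<longleftrightarrow> \<omega> \<in> {}"
        using pos by auto
      then show ?thesis
        unfolding space by (intro sets_subalgebra_AE_eq[OF sub null Ma, of "{}"]) auto
    qed
  qed
qed

text \<open>Rounding the time down to a multiple of \<open>1 / Suc m\<close> gives a process that
  reads \<open>X\<close> at countably many times only and is therefore jointly measurable. Path
  continuity makes these processes converge pointwise to \<open>X\<close>.\<close>

lemma borel_measurable_pair_continuous_paths:
  fixes X :: "real \<Rightarrow> 'a \<Rightarrow> real"
  assumes [measurable]: "\<And>t. X t \<in> borel_measurable M"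
    and cont: "\<And>\<omega>. \<omega> \<in> space M \<Longrightarrow> continuous_on UNIV (\<lambda>t. X t \<omega>)"
  shows "(\<lambda>(s, \<omega>). X s \<omega>) \<in> borel_measurable (borel \<Otimes>\<^sub>M M)"
proof (rule borel_measurable_LIMSEQ_real)
  define g where "g m s = real_of_int \<lfloor>s * real (Suc m)\<rfloor> / real (Suc m)" for m s
  show "(\<lambda>p. X (g m (fst p)) (snd p)) \<in> borel_measurable (borel \<Otimes>\<^sub>M M)" for m
    unfolding g_def by (rule measurable_compose_countable[where f="\<lambda>i p. X (real_of_int i / real (Suc m)) (snd p)"]) measurable
  fix p assume p: "p \<in> space (borel \<Otimes>\<^sub>M M :: (real \<times> 'a) measure)"
  have "(\<lambda>m. g m (fst p)) \<longlonglongrightarrow> fst p"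
  proof (rule tendsto_sandwich)
    have floor_bounds: "s - 1 / K \<le> of_int \<lfloor>s * K\<rfloor> / K" "of_int \<lfloor>s * K\<rfloor> / K \<le> s" if "0 < K" for s K :: real
    proof -
      have "(s * K - 1) / K \<le> of_int \<lfloor>s * K\<rfloor> / K" "of_int \<lfloor>s * K\<rfloor> / K \<le> (s * K) / K"
        using that by (intro divide_right_mono; linarith)+
      then show "s - 1 / K \<le> of_int \<lfloor>s * K\<rfloor> / K" "of_int \<lfloor>s * K\<rfloor> / K \<le> s"
        using that by (simp_all add: diff_divide_distrib)
    qed
    have "fst p - 1 / real (Suc m) \<le> g m (fst p)" for m
      unfolding g_def by (rule floor_bounds) simp
    then show "\<forall>\<^sub>F m in sequentially. fst p - 1 / real (Suc m) \<le> g m (fst p)" by simp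
    have "g m (fst p) \<le> fst p" for m
      unfolding g_def by (rule floor_bounds) simp
    then show "\<forall>\<^sub>F m in sequentially. g m (fst p) \<le> fst p" by simp
    show "(\<lambda>m. fst p - 1 / real (Suc m)) \<longlonglongrightarrow> fst p"
      using tendsto_diff[OF tendsto_const LIMSEQ_inverse_real_of_nat, of "fst p"] by (simp add: inverse_eq_divide)
  qed simp
  moreover have "isCont (\<lambda>t. X t (snd p)) (fst p)"
    using cont[of "snd p"] p by (auto simp: space_pair_measure continuous_on_eq_continuous_at)
  ultimately show "(\<lambda>m. X (g m (fst p)) (snd p)) \<longlonglongrightarrow> (case p of (s, \<omega>) \<Rightarrow> X s \<omega>)"
    by (auto simp: split_beta intro: isCont_tendsto_compose)
qed

section \<open>Propagation of the error from step to step\<close>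

lemma implicit_step_error:
  fixes x y x' y' :: real
  assumes pos: "0 < x'" "0 < y'"
    and mu: "\<And>x y. 0 < x \<Longrightarrow> 0 < y \<Longrightarrow> (x - y) * (\<mu> x - \<mu> y) \<le> L * (x - y)\<^sup>2"
    and L: "0 \<le> L" and h: "0 \<le> h" "h \<le> m" "m * L < 1"
    and eq: "x' - y' = x - y + R + h * (\<mu> x' - \<mu> y')"
  shows "\<bar>x' - y'\<bar> \<le> 1 / (1 - m * L) * (\<bar>x - y\<bar> + \<bar>R\<bar>)"
proof (cases "x' = y'")
  case True
  then show ?thesis using h by simp
next
  case False
  define e where "e = x' - y'"
  have "e * e = e * (x - y + R) + h * (e * (\<mu> x' - \<mu> y'))"
    using eq unfolding e_def by (metis (no_types, lifting) distrib_left mult.left_commute)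
  also have "\<dots> \<le> \<bar>e\<bar> * (\<bar>x - y\<bar> + \<bar>R\<bar>) + h * (L * (\<bar>e\<bar> * \<bar>e\<bar>))"
  proof (intro add_mono mult_left_mono[OF _ h(1)])
    have "e * (x - y + R) \<le> \<bar>e\<bar> * \<bar>x - y + R\<bar>"
      by (metis abs_ge_self abs_mult)
    also have "\<dots> \<le> \<bar>e\<bar> * (\<bar>x - y\<bar> + \<bar>R\<bar>)"
      by (intro mult_left_mono) auto
    finally show "e * (x - y + R) \<le> \<bar>e\<bar> * (\<bar>x - y\<bar> + \<bar>R\<bar>)" .
    show "e * (\<mu> x' - \<mu> y') \<le> L * (\<bar>e\<bar> * \<bar>e\<bar>)"
      using mu[OF pos] by (simp add: e_def power2_eq_square)
  qed
  also have "e * e = \<bar>e\<bar> * \<bar>e\<bar>" by simp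
  finally have "\<bar>e\<bar> * (\<bar>e\<bar> * (1 - h * L)) \<le> \<bar>e\<bar> * (\<bar>x - y\<bar> + \<bar>R\<bar>)"
    by (simp add: algebra_simps)
  then have "\<bar>e\<bar> * (1 - h * L) \<le> \<bar>x - y\<bar> + \<bar>R\<bar>"
    using False by (simp add: e_def)
  \<comment> \<open>Replacing the step size \<open>h\<close> by its upper bound \<open>m\<close>
    gives an amplification factor common to all steps.\<close>
  moreover have "\<bar>e\<bar> * (1 - m * L) \<le> \<bar>e\<bar> * (1 - h * L)"
    using h L by (intro mult_left_mono) (auto intro: mult_right_mono)
  ultimately show ?thesis
    using h(3) by (simp add: e_def field_simps)
qed

text \<open>Each \<open>I j\<close> is multiplied by \<open>C\<close> once per later step, hence at
  most \<open>n\<close> times. As \<open>C \<ge> 1\<close>, the single factor \<open>C ^ n\<close>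
  dominates all these powers.\<close>

lemma discrete_Gronwall_ennreal:
  fixes E I :: "nat \<Rightarrow> ennreal" and C :: real
  assumes C: "1 \<le> C" and E0: "E 0 = 0"
    and step: "\<And>k. k < n \<Longrightarrow> E (Suc k) \<le> ennreal C * (E k + I k)"
    and k: "k \<le> n"
  shows "E k \<le> ennreal (C ^ n) * (\<Sum>j<n. I j)"
proof -
  have "E k \<le> ennreal (C ^ k) * (\<Sum>j<k. I j)" if "k \<le> n" for k
    using that
  proof (induction k)
    case 0
    then show ?case by (simp add: E0)
  next
    case (Suc k)
    have one: "1 \<le> ennreal (C ^ k)"
      using C one_le_power[of C k] by (metis ennreal_1 ennreal_leI)
    have "E (Suc k) \<le> ennreal C * (E k + I k)"
      using Suc.prems by (intro step) auto
    also have "\<dots> \<le> ennreal C * (ennreal (C ^ k) * (\<Sum>j<k. I j) + ennreal (C ^ k) * I k)"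
      using Suc one mult_right_mono[OF one, of "I k"] by (intro mult_left_mono add_mono) auto
    also have "\<dots> = ennreal (C ^ Suc k) * (\<Sum>j<Suc k. I j)"
      using C by (simp add: ennreal_mult distrib_left ac_simps)
    finally show ?case .
  qed
  from this[OF k] show ?thesis
    by (rule order_trans)
       (use k C in \<open>auto intro!: mult_mono ennreal_leI power_increasing sum_mono2\<close>)
qed

section \<open>The time grid and the integral over one step\<close>

lemma time_partition_mono:
  assumes "time_partition T n \<theta>" "i \<le> j" "j \<le> n"
  shows "\<theta> i \<le> \<theta> j"
  using assms(2,3)
proof (induction j rule: dec_induct)
  case (step j)
  then show ?case
    using assms(1) by (auto simp: time_partition_def Suc_le_eq intro: order_trans[OF _ less_imp_le])
qed simp

lemma time_partition_in_range: "time_partition T n \<theta> \<Longrightarrow> k \<le> n \<Longrightarrow> \<theta> k \<in> {0..T}"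
  by (simp add: time_partition_def)

lemma time_partition_less: "time_partition T n \<theta> \<Longrightarrow> k < n \<Longrightarrow> \<theta> k < \<theta> (Suc k)"
  by (simp add: time_partition_def)

lemma time_partition_step_le_mesh:
  assumes "time_partition T n \<theta>" "k < n"
  shows "\<theta> (Suc k) - \<theta> k \<le> mesh n \<theta>"
proof -
  have "\<bar>\<theta> (Suc k) - \<theta> (Suc k - 1)\<bar> \<le> mesh n \<theta>"
    unfolding mesh_def using assms(2) by (intro Max_ge insertI2 imageI) auto
  then show ?thesis by simp
qed

lemma mesh_nonneg: "0 \<le> mesh n \<theta>"
  unfolding mesh_def by (intro Max_ge) auto

text \<open>Every grid point above \<open>s\<close> has index larger than \<open>k\<close>. The
  interval is open on the left because \<open>\<theta> k\<close> is its own ceiling; this is why the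
  local errors are integrated over half-open intervals.\<close>

lemma grid_ceil_eq:
  assumes part: "time_partition T n \<theta>" and k: "k < n" and s: "s \<in> {\<theta> k<..\<theta> (Suc k)}"
  shows "grid_ceil T n \<theta> s = \<theta> (Suc k)"
  unfolding grid_ceil_def
proof (rule cInf_eq_minimum)
  show "\<theta> (Suc k) \<in> \<theta> ` {0..n} \<inter> {s..T}"
    using k s time_partition_in_range[OF part, of "Suc k"] by auto
  fix x assume "x \<in> \<theta> ` {0..n} \<inter> {s..T}"
  then obtain j where j: "x = \<theta> j" "j \<le> n" "s \<le> \<theta> j" by auto
  then have "k < j"
    using time_partition_mono[OF part, of j k] k s by (cases "k < j") auto
  then show "\<theta> (Suc k) \<le> x"
    using time_partition_mono[OF part, of "Suc k" j] j by auto
qed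

text \<open>Bounds the residual of the implicit rectangle rule: \<open>f\<close> will be the drift
  along a path and \<open>a\<close> its value at the right end \<open>t\<close>. The increment is an
  integral over \<open>{s<..t}\<close>, as is \<open>(t - s) * a\<close>.\<close>

lemma set_integral_increment_error:
  fixes f :: "real \<Rightarrow> real"
  assumes f: "set_integrable lborel {0..T} f" and st: "0 \<le> s" "s \<le> t" "t \<le> T"
  shows "ennreal \<bar>(LINT r:{0..t}|lborel. f r) - (LINT r:{0..s}|lborel. f r) - (t - s) * a\<bar>
    \<le> (\<integral>\<^sup>+ r. ennreal \<bar>f r - a\<bar> * indicator {s<..t} r \<partial>lborel)"
proof -
  have int: "set_integrable lborel A f" if "A \<in> sets lborel" "A \<subseteq> {0..T}" for A
    using set_integrable_subset[OF f that] .
  have ints: "set_integrable lborel {s<..t} (\<lambda>r. f r - a)"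
    using st by (intro set_integral_diff int) (auto simp: set_integrable_def)
  have "{0..t} = {0..s} \<union> {s<..t}" using st by auto
  then have "(LINT r:{0..t}|lborel. f r) = (LINT r:{0..s}|lborel. f r) + (LINT r:{s<..t}|lborel. f r)"
    using st by (simp, intro set_integral_Un int) auto
  moreover have "(LINT r:{s<..t}|lborel. f r - a) = (LINT r:{s<..t}|lborel. f r) - (t - s) * a"
  proof (subst set_integral_diff(2))
    show "set_integrable lborel {s<..t} f"
      using st by (intro int) auto
  qed (use st in \<open>auto simp: set_integrable_def set_lebesgue_integral_def\<close>)
  ultimately have "\<bar>(LINT r:{0..t}|lborel. f r) - (LINT r:{0..s}|lborel. f r) - (t - s) * a\<bar>
      = norm (LINT r:{s<..t}|lborel. f r - a)"
    by simp
  also have "ennreal \<dots> \<le> (\<integral>\<^sup>+ r. ennreal (norm (indicator {s<..t} r *\<^sub>R (f r - a))) \<partial>lborel)"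
    using ints unfolding set_lebesgue_integral_def set_integrable_def
    by (rule integral_norm_bound_ennreal)
  also have "\<dots> = (\<integral>\<^sup>+ r. ennreal \<bar>f r - a\<bar> * indicator {s<..t} r \<partial>lborel)"
    by (intro nn_integral_cong) (auto simp: indicator_def)
  finally show ?thesis .
qed

section \<open>Positivity of the scheme and the expected local error\<close>

text \<open>The two claims need a joint induction: positivity at \<open>Suc k\<close> uses
  adaptedness at \<open>k\<close>, and adaptedness at \<open>Suc k\<close> uses positivity at
  \<open>Suc k\<close>.\<close>

lemma (in standard_brownian_motion) implicit_Euler_positive_adapted:
  fixes \<mu> :: "real \<Rightarrow> real" and Z :: "nat \<Rightarrow> 'a \<Rightarrow> real"
  assumes part: "time_partition T n \<theta>" and L: "0 \<le> L" "L * mesh n \<theta> < 1"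
    and mu: "\<And>x y. 0 < x \<Longrightarrow> 0 < y \<Longrightarrow> (x - y) * (\<mu> x - \<mu> y) \<le> L * (x - y)\<^sup>2"
    and meas: "\<And>k. k \<le> n \<Longrightarrow> Z k \<in> borel_measurable M"
    and nonneg: "\<And>k \<omega>. k \<le> n \<Longrightarrow> \<omega> \<in> space M \<Longrightarrow> 0 \<le> Z k \<omega>"
    and start: "U \<in> borel_measurable (F 0)" "AE \<omega> in M. 0 < U \<omega>" "AE \<omega> in M. Z 0 \<omega> = U \<omega>"
    and step: "\<And>k. k < n \<Longrightarrow> AE \<omega> in M. Z (Suc k) \<omega> =
        Z k \<omega> + \<mu> (Z (Suc k) \<omega>) * (\<theta> (Suc k) - \<theta> k) + W (\<theta> (Suc k)) \<omega> - W (\<theta> k) \<omega>"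
    and k: "k \<le> n"
  shows "(AE \<omega> in M. 0 < Z k \<omega>) \<and> Z k \<in> borel_measurable (F (\<theta> k))"
  using k
proof (induction k)
  case 0
  have \<theta>0: "\<theta> 0 = 0" "0 \<in> {0..T}"
    using part time_partition_in_range[OF part, of 0] by (auto simp: time_partition_def)
  have pos: "AE \<omega> in M. 0 < Z 0 \<omega>"
    using start(2,3) by eventually_elim simp
  \<comment> \<open>A step of length 0: \<open>Z 0\<close> equals the \<open>F 0\<close>-measurable
    \<open>U\<close> almost surely.\<close>
  have "Z 0 \<in> borel_measurable (F 0)"
    by (rule implicit_step_measurable[OF subalgebra_F[OF \<theta>0(2)] F_null_sets meas[of 0] start(1) pos _ _ _ mu, where h = 0])
       (use start(3) in auto)
  with pos show ?case by (simp add: \<theta>0)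
next
  case (Suc k)
  let ?s = "\<theta> k" and ?t = "\<theta> (Suc k)"
  have st: "?s \<in> {0..T}" "?t \<in> {0..T}" "?s < ?t"
    using Suc.prems time_partition_in_range[OF part] time_partition_less[OF part, of k] by auto
  have IH: "AE \<omega> in M. 0 < Z k \<omega>" "Z k \<in> borel_measurable (F ?s)"
    using Suc by auto
  \<comment> \<open>The excluded value is the one that the scheme would force if
    \<open>Z (Suc k)\<close> were 0.\<close>
  have "AE \<omega> in M. Z k \<omega> + (W ?t \<omega> - W ?s \<omega>) \<noteq> - \<mu> 0 * (?t - ?s)"
    using st by (intro indep_sum_no_atom[OF subalgebra_F IH(2) increment_indep increment_normal]) auto
  moreover have "AE \<omega> in M. 0 \<le> Z (Suc k) \<omega>"
    using nonneg[OF Suc.prems] by auto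
  ultimately have pos: "AE \<omega> in M. 0 < Z (Suc k) \<omega>"
    using step[OF Suc_le_lessD[OF Suc.prems]]
  proof eventually_elim
    case (elim \<omega>)
    then show ?case by (cases "Z (Suc k) \<omega> = 0") auto
  qed
  have sub: "subalgebra (F ?t) (F ?s)"
    using subalgebra_F[OF st(1)] subalgebra_F[OF st(2)] F_mono[OF st(1,2)] st(3)
    by (auto simp: subalgebra_def)
  have null: "null_sets M \<subseteq> sets (F ?t)"
    using F_null_sets F_mono[of 0 ?t] st by auto
  have W: "W ?s \<in> borel_measurable (F ?s)" "W ?t \<in> borel_measurable (F ?t)"
    using adapted st by (auto simp: adapted_process_def)
  have "(\<lambda>\<omega>. Z k \<omega> + (W ?t \<omega> - W ?s \<omega>)) \<in> borel_measurable (F ?t)"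
    using measurable_from_subalg[OF sub] IH(2) W by (intro borel_measurable_add borel_measurable_diff) auto
  moreover have "AE \<omega> in M. Z (Suc k) \<omega> = Z k \<omega> + (W ?t \<omega> - W ?s \<omega>) + \<mu> (Z (Suc k) \<omega>) * (?t - ?s)"
    using step[of k] Suc.prems by (auto elim!: eventually_mono simp: algebra_simps)
  moreover have "(?t - ?s) * L < 1"
    using mult_right_mono[OF time_partition_step_le_mesh[OF part, of k] L(1)] L(2) Suc.prems
    by (simp add: mult.commute)
  ultimately have "Z (Suc k) \<in> borel_measurable (F ?t)"
    using st by (intro implicit_step_measurable[OF subalgebra_F null meas _ pos _ _ _ mu]) (use Suc.prems in auto)
  with pos show ?case by simp
qed

text \<open>Positivity of \<open>X r\<close> holds almost surely for each fixed \<open>r\<close>,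
  with a null set that may depend on \<open>r\<close>. Tonelli's theorem therefore comes first, so
  that the expectation can be estimated at fixed \<open>r\<close>. The globally Borel function
  \<open>m\<close> in place of \<mu> provides the joint measurability.\<close>

lemma (in stochastic_basis) nn_integral_drift_increment_le:
  fixes \<mu> :: "real \<Rightarrow> real" and X :: "real \<Rightarrow> 'a \<Rightarrow> real" and D :: "'a \<Rightarrow> ennreal"
  assumes s: "0 \<le> s" "s \<le> t" "t \<le> T"
    and m [measurable]: "m \<in> borel_measurable borel" and m_eq: "\<And>x. 0 < x \<Longrightarrow> m x = \<mu> x"
    and X: "\<And>r. X r \<in> borel_measurable M" "\<And>\<omega>. \<omega> \<in> space M \<Longrightarrow> continuous_on UNIV (\<lambda>r. X r \<omega>)"
    and pos: "\<And>r. r \<in> {s<..t} \<Longrightarrow> AE \<omega> in M. 0 < X r \<omega>"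
    and c: "0 \<le> c" and eps: "0 < \<epsilon>" and g: "0 < \<gamma>" "\<gamma> \<le> 1"
    and growth: "\<And>x y. 0 < x \<Longrightarrow> 0 < y \<Longrightarrow>
      \<bar>\<mu> x - \<mu> y\<bar> \<le> c * \<bar>x - y\<bar> * (1 / x + 1 / y + 1 / (x * y) + x powr c + y powr c)"
    and D: "\<And>r \<omega>. r \<in> {s<..t} \<Longrightarrow> \<omega> \<in> space M \<Longrightarrow> ennreal \<bar>X r \<omega> - X t \<omega>\<bar> \<le> D \<omega>"
    and K: "\<And>r. r \<in> {s<..t} \<Longrightarrow> weight_norm M c \<gamma> \<epsilon> (X r) \<le> K"
  defines "I \<equiv> \<lambda>\<omega>. \<integral>\<^sup>+ r. ennreal \<bar>m (X r \<omega>) - m (X t \<omega>)\<bar> * indicator {s<..t} r \<partial>lborel"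
  shows "I \<in> borel_measurable M"
    and "(\<integral>\<^sup>+ \<omega>. I \<omega> \<partial>M)
      \<le> ennreal (t - s) * (ennreal (2 * c) * ennpowr (Lp_norm M (\<gamma> * (1 + 1 / \<epsilon>)) D) \<gamma> * K)"
proof -
  define B where "B = ennreal (2 * c) * ennpowr (Lp_norm M (\<gamma> * (1 + 1 / \<epsilon>)) D) \<gamma> * K"
  interpret P: pair_sigma_finite lborel M ..
  have "(\<lambda>(r, \<omega>). X r \<omega>) \<in> borel_measurable (lborel \<Otimes>\<^sub>M M)"
    using borel_measurable_pair_continuous_paths[of X M] X by simp
  then have XP [measurable]: "(\<lambda>p. X (fst p) (snd p)) \<in> borel_measurable (lborel \<Otimes>\<^sub>M M)"
    by (simp add: split_beta)
  note X(1) [measurable]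
  have G [measurable]: "(\<lambda>(r, \<omega>). ennreal \<bar>m (X r \<omega>) - m (X t \<omega>)\<bar> * indicator {s<..t} r)
      \<in> borel_measurable (lborel \<Otimes>\<^sub>M M)"
    unfolding split_beta by measurable
  show "I \<in> borel_measurable M"
    unfolding I_def using measurable_compose[OF measurable_pair_swap' G]
    by (intro lborel.borel_measurable_nn_integral) (simp add: split_beta)
  have "(\<integral>\<^sup>+ \<omega>. I \<omega> \<partial>M) =
      (\<integral>\<^sup>+ r. \<integral>\<^sup>+ \<omega>. ennreal \<bar>m (X r \<omega>) - m (X t \<omega>)\<bar> * indicator {s<..t} r \<partial>M \<partial>lborel)"
    unfolding I_def by (rule P.Fubini') (use G in simp)
  also have "\<dots> \<le> (\<integral>\<^sup>+ r. B * indicator {s<..t} r \<partial>lborel)"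
  proof (intro nn_integral_mono)
    fix r
    show "(\<integral>\<^sup>+ \<omega>. ennreal \<bar>m (X r \<omega>) - m (X t \<omega>)\<bar> * indicator {s<..t} r \<partial>M) \<le> B * indicator {s<..t} r"
    proof (cases "r \<in> {s<..t}")
      case True
      then have t: "t \<in> {s<..t}" by auto
      have "(\<integral>\<^sup>+ \<omega>. ennreal \<bar>m (X r \<omega>) - m (X t \<omega>)\<bar> \<partial>M) = (\<integral>\<^sup>+ \<omega>. ennreal \<bar>\<mu> (X r \<omega>) - \<mu> (X t \<omega>)\<bar> \<partial>M)"
        using pos[OF True] pos[OF t] by (intro nn_integral_cong_AE) (auto simp: m_eq)
      also have "\<dots> \<le> B"
        unfolding B_def
        by (rule nn_integral_drift_difference_le[OF X(1) X(1) pos[OF True] pos[OF t] c eps g growth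
              D[OF True] K[OF True] K[OF t]])
      finally show ?thesis using True by simp
    qed simp
  qed
  also have "\<dots> = ennreal (t - s) * B"
    using s by (simp add: nn_integral_cmult_indicator mult.commute)
  finally show "(\<integral>\<^sup>+ \<omega>. I \<omega> \<partial>M) \<le> ennreal (t - s) * B" .
qed

section \<open>Combination of the pathwise recursion with the expected local errors\<close>

theorem corollary3p9:
  fixes M :: "'a measure" and F :: "real \<Rightarrow> 'a measure"
    and W X Y :: "real \<Rightarrow> 'a \<Rightarrow> real"
    and T L c \<epsilon> \<gamma> :: real and \<mu> :: "real \<Rightarrow> real"
    and n :: nat and \<theta> :: "nat \<Rightarrow> real"
  assumes "0 \<le> T" and "0 \<le> L" and "0 \<le> c" and "0 < \<epsilon>" and "0 < \<gamma>" and "\<gamma> \<le> 1"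
    and mu_measurable: "\<mu> \<in> borel_measurable (restrict_space borel {0..})"
    and partition: "time_partition T n \<theta>"
    and step_size: "L * mesh n \<theta> < 1"
    and mu_one_sided: "\<And>x y. 0 < x \<Longrightarrow> 0 < y \<Longrightarrow> (x - y) * (\<mu> x - \<mu> y) \<le> L * (x - y)\<^sup>2"
    and mu_growth: "\<And>x y. 0 < x \<Longrightarrow> 0 < y \<Longrightarrow>
      \<bar>\<mu> x - \<mu> y\<bar> \<le> c * \<bar>x - y\<bar> * (1 / x + 1 / y + 1 / (x * y) + x powr c + y powr c)"
    and basis: "stochastic_basis M T F"
    and brownian: "standard_brownian_motion M T F W"
    and X_nonneg: "\<And>t \<omega>. t \<in> {0..T} \<Longrightarrow> \<omega> \<in> space M \<Longrightarrow> 0 \<le> X t \<omega>"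
    and X_adapted: "adapted_process T F X"
    and X_continuous: "\<And>\<omega>. \<omega> \<in> space M \<Longrightarrow> continuous_on {0..T} (\<lambda>t. X t \<omega>)"
    and X_drift_integrable:
      "AE \<omega> in M. (\<integral>\<^sup>+ s \<in> {0..T}. ennreal \<bar>\<mu> (X s \<omega>)\<bar> \<partial>lborel) < \<infinity>"
    and X_no_zero: "(SUP s\<in>{0..T}. measure M {\<omega> \<in> space M. X s \<omega> = 0}) = 0"
    and X_sde: "\<And>t. t \<in> {0..T} \<Longrightarrow>
      AE \<omega> in M. X t \<omega> = X 0 \<omega> + (LINT s:{0..t}|lborel. \<mu> (X s \<omega>)) + W t \<omega>"
    and Y_nonneg: "\<And>k \<omega>. k \<le> n \<Longrightarrow> \<omega> \<in> space M \<Longrightarrow> 0 \<le> Y (\<theta> k) \<omega>"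
    and Y_measurable:
      "(\<lambda>(t, \<omega>). Y t \<omega>) \<in> borel_measurable (restrict_space borel (\<theta> ` {0..n}) \<Otimes>\<^sub>M M)"
    and Y_start: "AE \<omega> in M. Y 0 \<omega> = X 0 \<omega>"
    and Y_step: "\<And>k. k < n \<Longrightarrow>
      AE \<omega> in M. Y (\<theta> (Suc k)) \<omega> =
        Y (\<theta> k) \<omega> + \<mu> (Y (\<theta> (Suc k)) \<omega>) * (\<theta> (Suc k) - \<theta> k) + W (\<theta> (Suc k)) \<omega> - W (\<theta> k) \<omega>"
  shows
    "Lp_norm M 1 (\<lambda>\<omega>. SUP k\<in>{0..n}. ennreal \<bar>X (\<theta> k) \<omega> - Y (\<theta> k) \<omega>\<bar>)
     \<le> ennreal (2 * T * c * (1 / (1 - mesh n \<theta> * L)) ^ n)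
        * ennpowr
            (Lp_norm M (\<gamma> * (1 + 1 / \<epsilon>))
              (\<lambda>\<omega>. SUP u\<in>{0..T}. ennreal \<bar>X u \<omega> - X (grid_ceil T n \<theta> u) \<omega>\<bar>)) \<gamma>
        * (SUP u\<in>{0..T}.
            Lp_norm M (1 + \<epsilon>) (\<lambda>\<omega>. 2 / ennpowr (ennreal (X u \<omega>)) (1 + \<gamma>))
            + ennreal (\<gamma> / (1 + \<gamma>))
              * Lp_norm M (1 + \<epsilon>) (\<lambda>\<omega>. ennpowr (ennreal (X u \<omega>)) (1 / \<gamma> - \<gamma>))
            + 2 * Lp_norm M (1 + \<epsilon>) (\<lambda>\<omega>. ennpowr (ennreal (X u \<omega>)) (c + 1 - \<gamma>))
            + ennreal (1 / (1 + \<gamma>)))"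
proof -
  interpret standard_brownian_motion M T F W by (rule brownian)
  note part = partition
  \<comment> \<open>\<open>m\<close> extends \<mu> to a Borel function on the whole line. Likewise,
    \<open>Xc\<close> below freezes \<open>X\<close> outside \<open>{0..T}\<close>, which makes its
    paths continuous on the whole line.\<close>
  define m where "m x = \<mu> (max 0 x)" for x
  define clamp where "clamp r = max 0 (min T r)" for r
  define Xc where "Xc r \<omega> = X (clamp r) \<omega>" for r \<omega>
  define D where "D \<omega> = (SUP u\<in>{0..T}. ennreal \<bar>X u \<omega> - X (grid_ceil T n \<theta> u) \<omega>\<bar>)" for \<omega>
  define K where "K = (SUP u\<in>{0..T}. weight_norm M c \<gamma> \<epsilon> (X u))"
  define B where "B = ennreal (2 * c) * ennpowr (Lp_norm M (\<gamma> * (1 + 1 / \<epsilon>)) D) \<gamma> * K"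
  define C where "C = 1 / (1 - mesh n \<theta> * L)"
  define I where "I k \<omega> = (\<integral>\<^sup>+ r. ennreal \<bar>m (Xc r \<omega>) - m (Xc (\<theta> (Suc k)) \<omega>)\<bar> *
      indicator {\<theta> k<..\<theta> (Suc k)} r \<partial>lborel)" for k \<omega>
  have clamp: "clamp r \<in> {0..T}" "r \<in> {0..T} \<Longrightarrow> clamp r = r" for r
    using \<open>0 \<le> T\<close> by (auto simp: clamp_def)
  have Xc_eq: "Xc r = X r" if "r \<in> {0..T}" for r
    using clamp(2)[OF that] by (simp add: Xc_def fun_eq_iff)
  note range = time_partition_in_range[OF part]
  have m_eq: "m x = \<mu> x" if "0 \<le> x" for x
    using that by (simp add: m_def)
  have [measurable]: "m \<in> borel_measurable borel"
    unfolding m_def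
    by (rule measurable_compose[OF _ mu_measurable]) (auto intro!: measurable_restrict_space2)
  have X_meas: "X t \<in> borel_measurable M" if "t \<in> {0..T}" for t
    using X_adapted that by (intro measurable_from_subalg[OF subalgebra_F[OF that]]) (simp add: adapted_process_def)
  have X_pos: "AE \<omega> in M. 0 < X t \<omega>" if t: "t \<in> {0..T}" for t
  proof -
    have [measurable]: "X t \<in> borel_measurable M" by (rule X_meas[OF t])
    \<comment> \<open>The supremum is a real one, so the family must be bounded above; probabilities
      are at most 1.\<close>
    have "measure M {\<omega> \<in> space M. X t \<omega> = 0} \<le> (SUP s\<in>{0..T}. measure M {\<omega> \<in> space M. X s \<omega> = 0})"
      using t by (intro cSUP_upper) (auto intro!: bdd_aboveI[of _ 1])
    then have "emeasure M {\<omega> \<in> space M. X t \<omega> = 0} = 0"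
      using X_no_zero by (simp add: emeasure_eq_measure measure_le_0_iff)
    then have "AE \<omega> in M. X t \<omega> \<noteq> 0"
      by (subst AE_iff_measurable[OF _ refl]) auto
    moreover have "AE \<omega> in M. 0 \<le> X t \<omega>"
      using X_nonneg[OF t] by auto
    ultimately show ?thesis by eventually_elim auto
  qed
  have Xc_cont: "continuous_on UNIV (\<lambda>r. Xc r \<omega>)" if "\<omega> \<in> space M" for \<omega>
    unfolding Xc_def
    by (rule continuous_on_compose2[OF X_continuous[OF that]])
       (use clamp(1) in \<open>auto simp: clamp_def intro!: continuous_intros\<close>)

  have mL: "mesh n \<theta> * L < 1" "0 \<le> mesh n \<theta> * L"
    using step_size \<open>0 \<le> L\<close> mesh_nonneg[of n \<theta>] by (auto simp: mult.commute)
  then have C: "1 \<le> C" by (simp add: C_def)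

  have Y_meas: "Y (\<theta> k) \<in> borel_measurable M" if "k \<le> n" for k
    using measurable_compose[OF measurable_Pair1' Y_measurable, of "\<theta> k"] that
    by (simp add: space_restrict_space)
  have \<theta>0: "\<theta> 0 = 0" using part by (simp add: time_partition_def)
  have Y_pos: "AE \<omega> in M. 0 < Y (\<theta> k) \<omega>" if "k \<le> n" for k
    using implicit_Euler_positive_adapted[OF part \<open>0 \<le> L\<close> step_size mu_one_sided,
        where Z = "\<lambda>k. Y (\<theta> k)" and U = "X 0" and k = k]
      Y_meas Y_nonneg Y_step X_pos[of 0] X_adapted Y_start that \<open>0 \<le> T\<close>
    by (auto simp: adapted_process_def \<theta>0)

  have I: "I k \<in> borel_measurable M" "(\<integral>\<^sup>+ \<omega>. I k \<omega> \<partial>M) \<le> ennreal (\<theta> (Suc k) - \<theta> k) * B"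
    if k: "k < n" for k
  proof -
    have st: "0 \<le> \<theta> k" "\<theta> k \<le> \<theta> (Suc k)" "\<theta> (Suc k) \<le> T"
      using range[of k] range[of "Suc k"] time_partition_less[OF part k] k by auto
    have in_range: "r \<in> {0..T}" if "r \<in> {\<theta> k<..\<theta> (Suc k)}" for r
      using that st by auto
    have D_bound: "ennreal \<bar>Xc r \<omega> - Xc (\<theta> (Suc k)) \<omega>\<bar> \<le> D \<omega>" if r: "r \<in> {\<theta> k<..\<theta> (Suc k)}" for r \<omega>
    proof -
      have "ennreal \<bar>X r \<omega> - X (grid_ceil T n \<theta> r) \<omega>\<bar> \<le> D \<omega>"
        unfolding D_def using in_range[OF r] by (intro SUP_upper)
      then show ?thesis
        using in_range[OF r] st by (simp add: grid_ceil_eq[OF part k r] Xc_eq)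
    qed
    have K_bound: "weight_norm M c \<gamma> \<epsilon> (Xc r) \<le> K" if r: "r \<in> {\<theta> k<..\<theta> (Suc k)}" for r
      unfolding K_def Xc_eq[OF in_range[OF r]] using in_range[OF r] by (intro SUP_upper)
    have Xc_meas: "Xc r \<in> borel_measurable M" for r
      using X_meas[OF clamp(1)] by (simp add: Xc_def[abs_def])
    have Xc_pos: "AE \<omega> in M. 0 < Xc r \<omega>" for r
      using X_pos[OF clamp(1)] by (simp add: Xc_def[abs_def])
    note * = nn_integral_drift_increment_le[OF st \<open>m \<in> borel_measurable borel\<close> m_eq Xc_meas Xc_cont Xc_pos
        \<open>0 \<le> c\<close> \<open>0 < \<epsilon>\<close> \<open>0 < \<gamma>\<close> \<open>\<gamma> \<le> 1\<close> mu_growth D_bound K_bound, folded B_def I_def]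
    show "I k \<in> borel_measurable M" "(\<integral>\<^sup>+ \<omega>. I k \<omega> \<partial>M) \<le> ennreal (\<theta> (Suc k) - \<theta> k) * B"
      using * by (auto simp: I_def[abs_def])
  qed

  have step: "AE \<omega> in M. \<forall>k\<in>{..<n}. ennreal \<bar>X (\<theta> (Suc k)) \<omega> - Y (\<theta> (Suc k)) \<omega>\<bar>
      \<le> ennreal C * (ennreal \<bar>X (\<theta> k) \<omega> - Y (\<theta> k) \<omega>\<bar> + I k \<omega>)"
  \<comment> \<open>There are finitely many steps, so their exceptional null sets can be treated
    separately.\<close>
  proof (intro AE_finite_allI)
    fix k assume "k \<in> {..<n}"
    then have k: "k < n" by simp
    let ?s = "\<theta> k" and ?t = "\<theta> (Suc k)"
    have st: "0 \<le> ?s" "?s \<le> ?t" "?t \<le> T" "?s \<in> {0..T}" "?t \<in> {0..T}"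
      using range[of k] range[of "Suc k"] time_partition_less[OF part k] k by auto
    have Y_pos': "AE \<omega> in M. 0 < Y ?t \<omega>"
      using k by (intro Y_pos) auto
    show "AE \<omega> in M. ennreal \<bar>X ?t \<omega> - Y ?t \<omega>\<bar> \<le> ennreal C * (ennreal \<bar>X ?s \<omega> - Y ?s \<omega>\<bar> + I k \<omega>)"
      using X_sde[OF st(4)] X_sde[OF st(5)] X_pos[OF st(5)] Y_pos' Y_step[OF k] X_drift_integrable AE_space
    proof eventually_elim
      case (elim \<omega>)
      \<comment> \<open>On \<open>{0..T}\<close> this is the drift along the path; being Borel on
        the whole line, it inherits integrability from the finite integral of the drift.\<close>
      define f where "f r = m (Xc r \<omega>)" for r
      have f_eq: "f r = \<mu> (X r \<omega>)" if "r \<in> {0..T}" for r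
        using X_nonneg[OF that elim(7)] by (simp add: f_def Xc_eq[OF that] m_eq)
      have [measurable]: "f \<in> borel_measurable borel"
        unfolding f_def using borel_measurable_continuous_onI[OF Xc_cont[OF elim(7)]] by measurable
      have "(\<integral>\<^sup>+ r\<in>{0..T}. ennreal \<bar>f r\<bar> \<partial>lborel) = (\<integral>\<^sup>+ r\<in>{0..T}. ennreal \<bar>\<mu> (X r \<omega>)\<bar> \<partial>lborel)"
        by (intro nn_integral_cong) (auto simp: indicator_def f_eq)
      then have f_int: "set_integrable lborel {0..T} f"
        unfolding set_integrable_def using elim(6)
        by (intro integrableI_bounded)
           (auto simp: abs_mult ennreal_mult' mult.commute ennreal_indicator)
      have LINT: "(LINT r:{0..u}|lborel. \<mu> (X r \<omega>)) = (LINT r:{0..u}|lborel. f r)" if "u \<in> {0..T}" for u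
        using that by (intro set_lebesgue_integral_cong) (auto simp: f_eq)
      define R where "R = (LINT r:{0..?t}|lborel. f r) - (LINT r:{0..?s}|lborel. f r) - (?t - ?s) * f ?t"
      have "ennreal \<bar>R\<bar> \<le> I k \<omega>"
        using set_integral_increment_error[OF f_int st(1-3), of "f ?t"] by (simp add: R_def I_def f_def)
      have "\<bar>X ?t \<omega> - Y ?t \<omega>\<bar> \<le> C * (\<bar>X ?s \<omega> - Y ?s \<omega>\<bar> + \<bar>R\<bar>)"
        unfolding C_def
      proof (rule implicit_step_error[OF elim(3,4) mu_one_sided \<open>0 \<le> L\<close> _ time_partition_step_le_mesh[OF part k] mL(1)])
        \<comment> \<open>The integral equation is subtracted at the two ends of the step.
          Subtracting the scheme then cancels the Brownian increment.\<close>
        have "X ?t \<omega> - X ?s \<omega> = R + (?t - ?s) * \<mu> (X ?t \<omega>) + (W ?t \<omega> - W ?s \<omega>)"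
          using elim(1,2) st by (simp add: LINT R_def f_eq)
        with elim(5) show "X ?t \<omega> - Y ?t \<omega> = X ?s \<omega> - Y ?s \<omega> + R + (?t - ?s) * (\<mu> (X ?t \<omega>) - \<mu> (Y ?t \<omega>))"
          by (simp add: algebra_simps)
      qed (use st in auto)
      then have "ennreal \<bar>X ?t \<omega> - Y ?t \<omega>\<bar> \<le> ennreal C * (ennreal \<bar>X ?s \<omega> - Y ?s \<omega>\<bar> + ennreal \<bar>R\<bar>)"
        using C by (simp add: ennreal_leI flip: ennreal_mult ennreal_plus)
      also have "\<dots> \<le> ennreal C * (ennreal \<bar>X ?s \<omega> - Y ?s \<omega>\<bar> + I k \<omega>)"
        using \<open>ennreal \<bar>R\<bar> \<le> I k \<omega>\<close> by (intro mult_left_mono add_left_mono) auto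
      finally show ?case .
    qed
  qed simp

  have "(\<integral>\<^sup>+ \<omega>. (SUP k\<in>{0..n}. ennreal \<bar>X (\<theta> k) \<omega> - Y (\<theta> k) \<omega>\<bar>) \<partial>M)
      \<le> (\<integral>\<^sup>+ \<omega>. ennreal (C ^ n) * (\<Sum>k<n. I k \<omega>) \<partial>M)"
  proof (rule nn_integral_mono_AE)
    show "AE \<omega> in M. (SUP k\<in>{0..n}. ennreal \<bar>X (\<theta> k) \<omega> - Y (\<theta> k) \<omega>\<bar>) \<le> ennreal (C ^ n) * (\<Sum>k<n. I k \<omega>)"
      using step Y_start
    proof eventually_elim
      case (elim \<omega>)
      show ?case
        \<comment> \<open>The error at index 0 vanishes by the common initial value; the bound does
          not depend on the index, so it passes to the supremum.\<close>
        using elim by (intro SUP_least discrete_Gronwall_ennreal[OF C]) (auto simp: \<theta>0)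
    qed
  qed
  also have "\<dots> = ennreal (C ^ n) * (\<Sum>k<n. \<integral>\<^sup>+ \<omega>. I k \<omega> \<partial>M)"
  proof -
    have "(\<lambda>\<omega>. \<Sum>k<n. I k \<omega>) \<in> borel_measurable M"
      using I(1) by (intro borel_measurable_sum) auto
    moreover have "(\<integral>\<^sup>+ \<omega>. (\<Sum>k<n. I k \<omega>) \<partial>M) = (\<Sum>k<n. \<integral>\<^sup>+ \<omega>. I k \<omega> \<partial>M)"
      using I(1) by (intro nn_integral_sum) auto
    ultimately show ?thesis by (simp add: nn_integral_cmult)
  qed
  also have "\<dots> \<le> ennreal (C ^ n) * (\<Sum>k<n. ennreal (\<theta> (Suc k) - \<theta> k) * B)"
    using I(2) by (intro mult_left_mono sum_mono) auto
  also have "(\<Sum>k<n. ennreal (\<theta> (Suc k) - \<theta> k) * B) = ennreal (\<Sum>k<n. \<theta> (Suc k) - \<theta> k) * B"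
  proof -
    have "(\<Sum>k<n. ennreal (\<theta> (Suc k) - \<theta> k)) = ennreal (\<Sum>k<n. \<theta> (Suc k) - \<theta> k)"
      using time_partition_less[OF part] by (intro sum_ennreal) (auto simp: less_imp_le)
    then show ?thesis by (simp flip: sum_distrib_right)
  qed
  \<comment> \<open>The step lengths telescope, which produces the factor \<open>T\<close>; for
    \<open>n = 0\<close> the sum is empty and \<open>T = 0\<close>.\<close>
  also have "(\<Sum>k<n. \<theta> (Suc k) - \<theta> k) = T"
    using part by (simp add: sum_lessThan_telescope time_partition_def)
  also have "ennreal (C ^ n) * (ennreal T * B) =
      ennreal (2 * T * c * C ^ n) * ennpowr (Lp_norm M (\<gamma> * (1 + 1 / \<epsilon>)) D) \<gamma> * K"
    using C \<open>0 \<le> T\<close> \<open>0 \<le> c\<close> by (simp add: B_def ennreal_mult ac_simps)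
  finally show ?thesis
    unfolding C_def D_def K_def weight_norm_def by (simp add: Lp_norm_def)
qed

end
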